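(* Fix a real number $0<\gamma\le 1$ and integers $q\ge 2$, $1\le s\le t$, and $m\ge 1$. Let $\mathcal C\subseteq\Sigma_q^n$ be an $(n,q,m+1;D_s)$-reconstruction code satisfying $r(x)\le\gamma n$ for every $x\in\mathcal C$. Then $\mathcal C$ is also an $(n,q,N+1;D_t)$-reconstruction code for some integer $N$ satisfying, as $n\to\infty$, \[ N\le \frac{m\gamma^{t-s}}{(t-s)!}\,n^{t-s}+O_{s,t,m}\!\left(n^{t-s-1}\right). \]
   Context: $\Sigma_q$ is an alphabet of size $q\ge2$, and $\Sigma_q^n$ is the set of sequences of length $n$ over $\Sigma_q$. For sequences $w,x$, write $w\preccurlyeq x$ if $w$ is a (not necessarily contiguous) subsequence of $x$. For $x\in\Sigma_q^n$ and $0\le t\le n$, the $t$-deletion ball is $D_t(x)=\{w\in\Sigma_q^{n-t}: w\preccurlyeq x\}$. $r(x)$ is the number of runs of $x$, i.e. of maximal blocks of consecutive identical symbols. An $(n,q,N;D_t)$-reconstruction code is a set $\mathcal C\subseteq\Sigma_q^n$ such that $|D_t(x)\cap D_t(y)|<N$ for any two distinct $x,y\in\mathcal C$. $O_{s,t,m}(f(n))$ denotes a quantity bounded in absolute value by $C f(n)$ for all sufficiently large $n$, where $C$ depends only on $s,t,m$ (in particular not on the code $\mathcal C$); how large $n$ must be may depend only on the fixed parameters $\gamma,q,s,t,m$. *)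

theory Defs
  imports Complex_Main "HOL-Library.Sublist"
begin

definition words :: "nat \<Rightarrow> nat \<Rightarrow> nat list set" where
  "words q n = {x. set x \<subseteq> {..<q} \<and> length x = n}"

(* Only meaningful for t \<le> length x, since the subtraction truncates. *)
definition deletion_ball :: "nat \<Rightarrow> nat \<Rightarrow> nat list \<Rightarrow> nat list set" where
  "deletion_ball q t x = {w \<in> words q (length x - t). subseq w x}"

(* The block of positions i, ..., j (both ends included) is constant and extends neither
   to the left nor to the right. *)
definition is_run :: "'a list \<Rightarrow> nat \<Rightarrow> nat \<Rightarrow> bool" where
  "is_run x i j \<longleftrightarrow>
     i \<le> j \<and> j < length x \<and> (\<forall>k\<in>{i..j}. x ! k = x ! i) \<and>
     (i = 0 \<or> x ! (i - 1) \<noteq> x ! i) \<and>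
     (Suc j = length x \<or> x ! Suc j \<noteq> x ! j)"

definition num_runs :: "'a list \<Rightarrow> nat" where
  "num_runs x = card {(i, j). is_run x i j}"

(* reconstruction_code n q N t C: C is an (n, q, N; D_t)-reconstruction code. *)
definition reconstruction_code :: "nat \<Rightarrow> nat \<Rightarrow> nat \<Rightarrow> nat \<Rightarrow> nat list set \<Rightarrow> bool" where
  "reconstruction_code n q N t C \<longleftrightarrow>
     C \<subseteq> words q n \<and>
     (\<forall>x\<in>C. \<forall>y\<in>C. x \<noteq> y \<longrightarrow> card (deletion_ball q t x \<inter> deletion_ball q t y) < N)"

end

theory Submission
  imports Defs
begin

text \<open>
  The number of \<^emph>\<open>maximal\<close> common subsequences that arise from \<open>x\<close> by \<open>a\<close> deletions and from \<open>y\<close>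
  by \<open>b\<close> deletions is at most \<open>(a + b) choose a\<close>, whatever the lengths of \<open>x\<close> and \<open>y\<close>: if the first
  letters agree, every maximal common subsequence starts with that letter; if they differ, it
  misses one of them, which gives Pascal's recursion.

  Let \<open>x \<noteq> y\<close> be codewords. An element of \<open>D\<^sub>t(x) \<inter> D\<^sub>t(y)\<close> extends to a maximal common
  subsequence \<open>z\<close>. If \<open>z\<close> has length at least \<open>n - s\<close>, the element lies below one of the at most
  \<open>m\<close> words of \<open>D\<^sub>s(x) \<inter> D\<^sub>s(y)\<close>, each of which has at most \<open>\<gamma> n\<close> runs; by Levenshtein's bound
  \<open>(r + k - 1) choose k\<close> for \<open>k\<close> deletions from a word with \<open>r\<close> runs, these contribute the leading
  term. Otherwise \<open>z\<close> has length \<open>n - j\<close> with \<open>s < j \<le> t\<close>; there are boundedly many such \<open>z\<close>,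
  each with \<open>O(n\<^bsup>t - j\<^esup>)\<close> elements below it.
\<close>

section \<open>Subsequences and runs\<close>

lemma finite_subseqs: "finite {w. subseq w x}"
  by (simp flip: set_subseqs_eq)

text \<open>Taking lengths, deleting letters never increases the number of runs, so the bound on the
  runs of a codeword passes to its subsequences.\<close>

lemma subseq_remdups_adj:
  "subseq w x \<Longrightarrow> subseq (remdups_adj w) (remdups_adj x)"
proof (induction rule: list_emb.induct)
  case (list_emb_Nil ys)
  then show ?case by simp
next
  case (list_emb_Cons xs ys y)
  then show ?case
    by (auto simp: remdups_adj_Cons split: list.split)
next
  case (list_emb_Cons2 x y xs ys)
  then show ?case
    by (auto simp: remdups_adj_Cons split: list.split
        dest: subseq_Cons') (meson list_emb.list_emb_Cons subseq_Cons')
qed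

lemma subseq_Cons_right_cases:
  assumes "subseq w (c # x)"
  obtains "subseq w x" | w' where "w = c # w'" "subseq w' x"
  using assms by (cases w) (auto split: if_splits)

text \<open>The missing letters of \<open>z\<close> can be put back into \<open>w\<close> one at a
  time, so every intermediate length occurs.\<close>

lemma subseq_interpolate:
  assumes "subseq w z" "length w \<le> k" "k \<le> length z"
  obtains v where "subseq w v" "subseq v z" "length v = k"
proof -
  have "\<exists>v. subseq w v \<and> subseq v z \<and> length v = k"
    using assms
  proof (induction arbitrary: k rule: list_emb.induct)
    case (list_emb_Nil ys)
    then show ?case
      by (intro exI[of _ "take k ys"]) (auto simp: take_is_prefix prefix_imp_subseq)
  next
    case (list_emb_Cons xs ys y)
    show ?case
    proof (cases "k \<le> length ys")
      case True
      then show ?thesis using list_emb_Cons by (meson list_emb.list_emb_Cons)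
    next
      case False
      then have "k = length (y # ys)" using list_emb_Cons by simp
      then show ?thesis using list_emb_Cons by (intro exI[of _ "y # ys"]) auto
    qed
  next
    case (list_emb_Cons2 x y xs ys)
    then obtain k' where k: "k = Suc k'" by (cases k) auto
    with list_emb_Cons2 obtain v where "subseq xs v" "subseq v ys" "length v = k'" by force
    with k list_emb_Cons2 show ?case by (intro exI[of _ "y # v"]) auto
  qed
  then show ?thesis using that by blast
qed

text \<open>Links the positional run count to \<open>remdups_adj\<close>, which suits list
  induction. The map \<open>f\<close> sends a position to the index of its run, so distinct indices
  yield distinct runs.\<close>

lemma length_remdups_adj_le_num_runs: "length (remdups_adj x) \<le> num_runs x"
proof -
  obtain f :: "nat \<Rightarrow> nat" where mono: "mono f"
    and im: "f ` {0..<length x} = {0..<length (remdups_adj x)}"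
    and nth: "\<And>i. i < length x \<Longrightarrow> x ! i = remdups_adj x ! f i"
    and adj: "\<And>i. i + 1 < length x \<Longrightarrow> x ! i = x ! (i + 1) \<longleftrightarrow> f i = f (i + 1)"
    using remdups_adj_altdef[of x "remdups_adj x"] by blast
  have run: "\<exists>i j. is_run x i j \<and> f i = k" if k: "k < length (remdups_adj x)" for k
  proof -
    \<comment> \<open>The fibre of \<open>f\<close> over \<open>k\<close> is a block because
      \<open>f\<close> is monotone; by \<open>adj\<close> it cannot be extended by an equal
      neighbour.\<close>
    define F where "F = {i. i < length x \<and> f i = k}"
    have fin: "finite F" by (simp add: F_def)
    have "k \<in> f ` {0..<length x}" using im k by simp
    then have "F \<noteq> {}" by (auto simp: F_def)
    then have mM: "Min F \<in> F" "Max F \<in> F" using fin by auto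
    have le: "Min F \<le> Max F" using fin \<open>F \<noteq> {}\<close> by (meson Max_ge mM(1))
    have const: "x ! l = x ! Min F" if "l \<in> {Min F..Max F}" for l
    proof -
      have "f l = k"
        using that mM monoD[OF mono, of "Min F" l] monoD[OF mono, of l "Max F"]
        by (auto simp: F_def)
      then show ?thesis using that mM nth[of l] nth[of "Min F"] by (auto simp: F_def)
    qed
    have left: "x ! (Min F - 1) \<noteq> x ! Min F" if "Min F \<noteq> 0"
    proof
      assume "x ! (Min F - 1) = x ! Min F"
      then have "Min F - 1 \<in> F" using adj[of "Min F - 1"] that mM by (auto simp: F_def)
      then show False using Min_le[OF fin, of "Min F - 1"] that by simp
    qed
    have right: "x ! Suc (Max F) \<noteq> x ! Max F" if "Suc (Max F) \<noteq> length x"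
    proof
      assume "x ! Suc (Max F) = x ! Max F"
      then have "Suc (Max F) \<in> F" using adj[of "Max F"] that mM by (auto simp: F_def)
      then show False using Max_ge[OF fin, of "Suc (Max F)"] by simp
    qed
    have "is_run x (Min F) (Max F)"
      unfolding is_run_def
    proof (intro conjI ballI)
      show "Max F < length x" using mM by (simp add: F_def)
    qed (use le const left right in blast)+
    then show ?thesis using mM by (auto simp: F_def)
  qed
  have "i < length x \<and> j < length x" if "is_run x i j" for i j
  proof -
    have "i \<le> j" "j < length x" using that unfolding is_run_def by blast+
    then show ?thesis by simp
  qed
  then have "{(i, j). is_run x i j} \<subseteq> {..<length x} \<times> {..<length x}"
    by auto
  then have fin: "finite {(i, j). is_run x i j}"
    by (rule finite_subset) simp
  have "{..<length (remdups_adj x)} \<subseteq> (\<lambda>(i, j). f i) ` {(i, j). is_run x i j}"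
  proof
    fix k assume "k \<in> {..<length (remdups_adj x)}"
    then obtain i j where "is_run x i j" "f i = k" using run[of k] by blast
    then show "k \<in> (\<lambda>(i, j). f i) ` {(i, j). is_run x i j}" by force
  qed
  then have "card {..<length (remdups_adj x)} \<le> card {(i, j). is_run x i j}"
    using fin by (rule surj_card_le[rotated])
  then show ?thesis by (simp add: num_runs_def)
qed

section \<open>Levenshtein's bound on the deletion ball\<close>

text \<open>The alphabet is left out, and the length condition is additive, so the set is empty when
  \<open>k\<close> exceeds \<open>length z\<close>.\<close>

definition deletions :: "nat \<Rightarrow> 'a list \<Rightarrow> 'a list set" where
  "deletions k z = {w. subseq w z \<and> length w + k = length z}"

lemma finite_deletions: "finite (deletions k z)"
  unfolding deletions_def by (rule finite_subset[OF _ finite_subseqs[of z]]) auto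

text \<open>A word below \<open>c # z\<close> either lies in \<open>E\<close> or survives in
  \<open>z\<close> with one deletion fewer. Bounding \<open>E\<close> in the same induction makes
  the two counts add up by Pascal's rule.\<close>

lemma card_deletions_le:
  "card (deletions k z) \<le> (length (remdups_adj z) + k - 1) choose k"
proof -
  \<comment> \<open>\<open>E k z\<close> collects the words that keep the whole first run of \<open>z\<close>, so only \<open>r - 1\<close> runs are free.\<close>
  define E where "E k z = {w \<in> deletions k z. \<not> subseq w (tl z)}" for k and z :: "'a list"
  have fin: "finite (deletions k z)" "finite (E k z)" for k and z :: "'a list"
    by (simp_all add: E_def finite_deletions)
  have "(z \<noteq> [] \<longrightarrow> card (E k z) \<le> (length (remdups_adj z) - 1 + k - 1) choose k)
    \<and> card (deletions k z) \<le> (length (remdups_adj z) + k - 1) choose k"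
  proof (induction z arbitrary: k)
    case Nil
    have "deletions k ([] :: 'a list) = (if k = 0 then {[]} else {})"
      by (auto simp: deletions_def)
    then show ?case by simp
  next
    case (Cons c z)
    define r where "r = length (remdups_adj (c # z))"
    note IH = Cons.IH
    have "r \<noteq> 0" by (simp add: r_def)
    have head: "E k (c # z) \<subseteq> (#) c ` {w \<in> deletions k z. \<not> subseq (c # w) z}"
      by (auto simp: E_def deletions_def elim!: subseq_Cons_right_cases)
    have le: "card (E k (c # z)) \<le> card A"
      if "finite A" "{w \<in> deletions k z. \<not> subseq (c # w) z} \<subseteq> A" for A
      using that by (intro surj_card_le[where f = "(#) c"] order.trans[OF head] image_mono)
    have E: "card (E k (c # z)) \<le> (r - 1 + k - 1) choose k"
    proof (cases z)
      case Nil
      then show ?thesis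
        using le[of "if k = 0 then {[]} else {}"] by (cases k) (auto simp: deletions_def r_def)
    next
      case (Cons d z')
      show ?thesis
      proof (cases "c = d")
        case True
        \<comment> \<open>The first run of \<open>z\<close> merely gets longer, so \<open>r\<close>
          is unchanged and the bound on \<open>E k z\<close> carries over.\<close>
        then have "{w \<in> deletions k z. \<not> subseq (c # w) z} \<subseteq> E k z"
          by (auto simp: E_def Cons)
        then show ?thesis
          using le[OF fin(2), of k z] IH[of k] True by (simp add: Cons r_def)
      next
        case False
        \<comment> \<open>Here \<open>c\<close> is a run of its own, so \<open>z\<close> has exactly
          \<open>r - 1\<close> runs.\<close>
        have "card (E k (c # z)) \<le> card (deletions k z)" by (intro le fin) auto
        then show ?thesis
          using IH[of k] False by (simp add: Cons r_def)
      qed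
    qed
    have D: "card (deletions k (c # z)) \<le> (r + k - 1) choose k"
    proof (cases k)
      case 0
      have "deletions 0 (c # z) \<subseteq> {c # z}" by (auto simp: deletions_def dest: subseq_same_length)
      then show ?thesis using 0 card_mono[of "{c # z}" "deletions 0 (c # z)"] by simp
    next
      case (Suc l)
      have "deletions k (c # z) \<subseteq> E k (c # z) \<union> deletions l z"
        by (auto simp: deletions_def E_def Suc)
      then have "card (deletions k (c # z)) \<le> card (E k (c # z)) + card (deletions l z)"
        by (meson card_Un_le card_mono fin finite_UnI le_trans)
      also have "card (deletions l z) \<le> (length (remdups_adj z) + l - 1) choose l"
        using IH by blast
      \<comment> \<open>With \<open>k = Suc l\<close> and \<open>r\<close> positive, both upper
        entries equal \<open>r + l - 1\<close>.\<close>
      also have "\<dots> \<le> (r + l - 1) choose l"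
        by (intro binomial_right_mono diff_le_mono add_right_mono)
          (simp add: r_def remdups_adj_Cons split: list.split)
      also have "card (E k (c # z)) + ((r + l - 1) choose l) \<le> (r + k - 1) choose k"
        using E \<open>r \<noteq> 0\<close> by (cases r) (auto simp: Suc)
      finally show ?thesis by simp
    qed
    from D E show ?case by (simp add: r_def)
  qed
  then show ?thesis by blast
qed

section \<open>Maximal common subsequences\<close>

text \<open>Maximality refers to the order \<open>subseq\<close>, so maximal words may have
  different lengths.\<close>

definition max_common_subseq :: "'a list \<Rightarrow> 'a list \<Rightarrow> 'a list \<Rightarrow> bool" where
  "max_common_subseq w x y \<longleftrightarrow> subseq w x \<and> subseq w y \<and>
     (\<forall>z. subseq z x \<and> subseq z y \<and> subseq w z \<longrightarrow> z = w)"

text \<open>A longest common subsequence above \<open>w\<close> is maximal.\<close>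

lemma max_common_subseq_extension:
  assumes "subseq w x" "subseq w y"
  obtains z where "max_common_subseq z x y" "subseq w z"
proof -
  let ?common = "\<lambda>z. subseq w z \<and> subseq z x \<and> subseq z y"
  have "\<forall>z. ?common z \<longrightarrow> length z < Suc (length x)"
    by (auto simp: less_Suc_eq_le dest: list_emb_length)
  with ex_has_greatest_nat[of ?common w length] assms
  obtain z where z: "?common z" and longest: "\<And>v. ?common v \<Longrightarrow> length v \<le> length z"
    by blast
  have "max_common_subseq z x y"
    unfolding max_common_subseq_def
  proof (intro conjI allI impI)
    fix v assume v: "subseq v x \<and> subseq v y \<and> subseq z v"
    then have "subseq w v" using z subseq_order.trans by blast
    then have "length v \<le> length z" using v longest by blast
    moreover have "length z \<le> length v" using v list_emb_length by blast
    ultimately show "v = z" using v subseq_same_length[of z v] by simp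
  qed (use z in auto)
  then show ?thesis using that z by blast
qed

text \<open>The separate budgets \<open>a\<close> and \<open>b\<close> serve the induction: when the
  first letters differ, only one of the two words is shortened, at the cost of one of its
  deletions.\<close>

lemma card_max_common_subseq:
  "card {w \<in> deletions a x \<inter> deletions b y. max_common_subseq w x y}
     \<le> (a + b) choose a"
proof (induction "length x + length y" arbitrary: x y a b rule: less_induct)
  case less
  define M where "M x y a b = {w \<in> deletions a x \<inter> deletions b y. max_common_subseq w x y}"
    for x y :: "'a list" and a b
  have fin: "finite (M x y a b)" for x y :: "'a list" and a b
    by (simp add: M_def finite_deletions)
  have IH: "card (M x' y' a' b') \<le> (a' + b') choose a'"
    if "length x' + length y' < length x + length y" for x' y' a' b'
    using less[OF that] by (simp add: M_def)
  consider "a = 0" | "b = 0" | "a > 0" "b > 0" "x = [] \<or> y = []"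
    | a' b' c d x' y' where "a = Suc a'" "b = Suc b'" "x = c # x'" "y = d # y'"
    by (cases a; cases b; cases x; cases y) auto
  then have "card (M x y a b) \<le> (a + b) choose a"
  proof cases
    case 1
    then have "M x y a b \<subseteq> {x}"
      by (auto simp: M_def deletions_def max_common_subseq_def dest: subseq_same_length)
    then show ?thesis using 1 card_mono[of "{x}" "M x y a b"] by simp
  next
    case 2
    then have "M x y a b \<subseteq> {y}"
      by (auto simp: M_def deletions_def max_common_subseq_def dest: subseq_same_length)
    then show ?thesis using 2 card_mono[of "{y}" "M x y a b"] by simp
  next
    case 3
    then have "M x y a b = {}" by (auto simp: M_def deletions_def)
    then show ?thesis by simp
  next
    case 4
    show ?thesis
    proof (cases "c = d")
      case True
      have "M x y a b \<subseteq> (#) c ` M x' y' a b"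
      proof
        fix w assume "w \<in> M x y a b"
        then have w: "subseq w (c # x')" "subseq w (c # y')"
          "length w + a = Suc (length x')" "length w + b = Suc (length y')"
          and max: "\<And>z. subseq z (c # x') \<Longrightarrow> subseq z (c # y') \<Longrightarrow> subseq w z \<Longrightarrow> z = w"
          using True 4 by (auto simp: M_def deletions_def max_common_subseq_def)
        have "\<exists>w'. w = c # w'"
        proof (rule ccontr)
          assume "\<not> ?thesis"
          then have "subseq w x'" "subseq w y'" using w by (auto elim!: subseq_Cons_right_cases)
          \<comment> \<open>Prepending the shared letter \<open>c\<close> would give a longer common
            subsequence.\<close>
          then show False using max[of "c # w"] by auto
        qed
        then obtain w' where w': "w = c # w'" ..
        have "z = w'" if "subseq z x'" "subseq z y'" "subseq w' z" for z
          using max[of "c # z"] that by (simp add: w')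
        then have "w' \<in> M x' y' a b"
          using w by (auto simp: M_def deletions_def max_common_subseq_def w')
        then show "w \<in> (#) c ` M x' y' a b" using w' by blast
      qed
      then have "card (M x y a b) \<le> card (M x' y' a b)"
        using fin by (rule surj_card_le[rotated])
      also have "\<dots> \<le> (a + b) choose a" using 4 by (intro IH) simp
      finally show ?thesis .
    next
      case False
      have "M x y a b \<subseteq> M x' y a' b \<union> M x y' a b'"
      proof
        fix w assume "w \<in> M x y a b"
        then have w: "subseq w (c # x')" "subseq w (d # y')"
          "length w + a' = length x'" "length w + b' = length y'"
          and max: "\<And>z. subseq z (c # x') \<Longrightarrow> subseq z (d # y') \<Longrightarrow> subseq w z \<Longrightarrow> z = w"
          using 4 by (auto simp: M_def deletions_def max_common_subseq_def)
        \<comment> \<open>\<open>w\<close> cannot start with both \<open>c\<close> and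
          \<open>d\<close>. Maximality survives, since common subsequences of the shortened pair are
          common to the original pair.\<close>
        have "subseq w x' \<or> subseq w y'"
          using w False by (auto elim!: subseq_Cons_right_cases)
        then show "w \<in> M x' y a' b \<union> M x y' a b'"
          using w max 4 by (auto simp: M_def deletions_def max_common_subseq_def)
      qed
      then have "card (M x y a b) \<le> card (M x' y a' b) + card (M x y' a b')"
        by (meson card_Un_le card_mono fin finite_UnI le_trans)
      also have "\<dots> \<le> ((a' + b) choose a') + ((a + b') choose a)"
        using 4 by (intro add_mono IH) auto
      also have "\<dots> = (a + b) choose a" using 4 by simp
      finally show ?thesis .
    qed
  qed
  then show ?case by (simp add: M_def)
qed

section \<open>Intersection of two deletion balls\<close>

lemma set_subseq_subset: "subseq w x \<Longrightarrow> set w \<subseteq> set x"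
  by (auto simp: subseq_conv_nths dest: in_set_nthsD)

text \<open>Subsequences inherit the alphabet, and \<open>t \<le> n\<close> keeps the subtraction in
  \<open>deletion_ball\<close> from truncating.\<close>

lemma deletion_ball_eq_deletions:
  assumes "x \<in> words q n" "t \<le> n"
  shows "deletion_ball q t x = deletions t x"
proof -
  have x: "set x \<subseteq> {..<q}" "length x = n" using assms by (auto simp: words_def)
  have "set w \<subseteq> {..<q}" if "subseq w x" for w
    using set_subseq_subset[OF that] x by blast
  moreover have "length w = n - t \<longleftrightarrow> length w + t = n" for w :: "nat list"
    using \<open>t \<le> n\<close> by linarith
  ultimately show ?thesis
    using x by (auto simp: deletion_ball_def deletions_def words_def)
qed

lemma card_common_deletions_le:
  assumes len: "length x = n" "length y = n" and "s \<le> t"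
    and m: "card (deletions s x \<inter> deletions s y) \<le> m"
    and r: "length (remdups_adj x) \<le> r"
  shows "card (deletions t x \<inter> deletions t y) \<le>
    m * ((r + (t - s) - 1) choose (t - s)) +
    (\<Sum>j\<in>{s<..t}. ((2 * j) choose j) * ((n + (t - j) - 1) choose (t - j)))"
proof -
  define S where "S = deletions s x \<inter> deletions s y"
  define M where "M j = {w \<in> deletions j x \<inter> deletions j y. max_common_subseq w x y}" for j
  define A where "A = (\<Union>z\<in>S. deletions (t - s) z)"
  define B where "B j = (\<Union>z\<in>M j. deletions (t - j) z)" for j
  have fin: "finite S" "finite (M j)" "finite A" "finite (B j)" for j
    by (auto simp: S_def M_def A_def B_def finite_deletions)
  have "deletions t x \<inter> deletions t y \<subseteq> A \<union> (\<Union>j\<in>{s<..t}. B j)"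
  proof
    fix w assume "w \<in> deletions t x \<inter> deletions t y"
    then have w: "subseq w x" "subseq w y" "length w + t = n"
      using len by (auto simp: deletions_def)
    then obtain z where z: "max_common_subseq z x y" "subseq w z"
      using max_common_subseq_extension[of w x y] by blast
    then have zxy: "subseq z x" "subseq z y" by (auto simp: max_common_subseq_def)
    have "length w \<le> length z" "length z \<le> n"
      using z zxy len by (auto dest: list_emb_length)
    show "w \<in> A \<union> (\<Union>j\<in>{s<..t}. B j)"
    proof (cases "n \<le> length z + s")
      case True
      \<comment> \<open>\<open>z\<close> may be longer than \<open>n - s\<close>; trimming it to
        that length without losing \<open>w\<close> gives an element of \<open>S\<close>.\<close>
      then have "n - s \<le> length z" "length w \<le> n - s" using w \<open>s \<le> t\<close> by auto
      then obtain v where v: "subseq w v" "subseq v z" "length v = n - s"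
        using subseq_interpolate[OF z(2)] by metis
      then have "subseq v x" "subseq v y" using zxy subseq_order.trans by blast+
      then have "v \<in> S" using v w len \<open>s \<le> t\<close> by (auto simp: S_def deletions_def)
      moreover have "w \<in> deletions (t - s) v" using v w \<open>s \<le> t\<close> by (auto simp: deletions_def)
      ultimately show ?thesis by (auto simp: A_def)
    next
      case False
      define j where "j = n - length z"
      have "j \<in> {s<..t}" "z \<in> M j" "w \<in> deletions (t - j) z"
        using False z zxy len w \<open>length w \<le> length z\<close> \<open>length z \<le> n\<close>
        by (auto simp: j_def M_def deletions_def)
      then show ?thesis by (auto simp: B_def)
    qed
  qed
  then have "card (deletions t x \<inter> deletions t y) \<le> card (A \<union> (\<Union>j\<in>{s<..t}. B j))"
    using fin by (intro card_mono) auto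
  also have "\<dots> \<le> card A + (\<Sum>j\<in>{s<..t}. card (B j))"
    by (intro order.trans[OF card_Un_le] add_left_mono card_UN_le) simp
  also have "card A \<le> (\<Sum>z\<in>S. card (deletions (t - s) z))"
    unfolding A_def using fin(1) by (rule card_UN_le)
  also have "\<dots> \<le> card S * ((r + (t - s) - 1) choose (t - s))"
  proof -
    have "card (deletions (t - s) z) \<le> (r + (t - s) - 1) choose (t - s)" if "z \<in> S" for z
    proof -
      have "subseq z x" using that by (simp add: S_def deletions_def)
      then have "length (remdups_adj z) \<le> r"
        using list_emb_length[OF subseq_remdups_adj] r le_trans by blast
      then have "length (remdups_adj z) + (t - s) - 1 \<le> r + (t - s) - 1" by linarith
      then show ?thesis by (rule order.trans[OF card_deletions_le binomial_right_mono])
    qed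
    then show ?thesis
      using sum_bounded_above[of S "\<lambda>z. card (deletions (t - s) z)"] by simp
  qed
  also have "\<dots> \<le> m * ((r + (t - s) - 1) choose (t - s))"
    using m by (simp add: S_def)
  also have "(\<Sum>j\<in>{s<..t}. card (B j)) \<le>
    (\<Sum>j\<in>{s<..t}. ((2 * j) choose j) * ((n + (t - j) - 1) choose (t - j)))"
  proof (rule sum_mono)
    fix j assume "j \<in> {s<..t}"
    \<comment> \<open>Bounding the number of runs by \<open>n\<close> suffices here, because
      \<open>t - j < t - s\<close>.\<close>
    have "card (deletions (t - j) z) \<le> (n + (t - j) - 1) choose (t - j)" if "z \<in> M j" for z
    proof -
      have "length z \<le> n" using that len by (auto simp: M_def deletions_def)
      then have "length (remdups_adj z) + (t - j) - 1 \<le> n + (t - j) - 1"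
        using remdups_adj_length[of z] by linarith
      then show ?thesis by (rule order.trans[OF card_deletions_le binomial_right_mono])
    qed
    then have "(\<Sum>z\<in>M j. card (deletions (t - j) z)) \<le>
        card (M j) * ((n + (t - j) - 1) choose (t - j))"
      using sum_bounded_above[of "M j" "\<lambda>z. card (deletions (t - j) z)"] by simp
    \<comment> \<open>Both words lose \<open>j\<close> letters, so the budgets are
      \<open>a = b = j\<close>.\<close>
    also have "card (M j) \<le> (2 * j) choose j"
      using card_max_common_subseq[of j x j y] by (simp add: M_def mult_2)
    finally show "card (B j) \<le> ((2 * j) choose j) * ((n + (t - j) - 1) choose (t - j))"
      using card_UN_le[OF fin(2)[of j], of "deletions (t - j)"] by (simp add: B_def)
  qed
  finally show ?thesis by simp
qed

section \<open>Asymptotic estimates\<close>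

text \<open>Every non-leading term of the binomial expansion carries at most
  \<open>n ^ (k - 1)\<close>, and the remaining coefficients sum to at most
  \<open>(1 + c) ^ k\<close>.\<close>

lemma add_power_le:
  fixes a c n :: real
  assumes "0 \<le> a" "a \<le> n" "1 \<le> n" "0 \<le> c" "k \<ge> 1"
  shows "(a + c) ^ k \<le> a ^ k + (1 + c) ^ k * n ^ (k - 1)"
proof -
  have "(a + c) ^ k = a ^ k + (\<Sum>i<k. real (k choose i) * a ^ i * c ^ (k - i))"
    by (simp add: binomial_ring flip: lessThan_Suc_atMost)
  also have "(\<Sum>i<k. real (k choose i) * a ^ i * c ^ (k - i))
    \<le> (\<Sum>i<k. n ^ (k - 1) * (real (k choose i) * 1 ^ i * c ^ (k - i)))"
  proof (rule sum_mono)
    fix i assume "i \<in> {..<k}"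
    have "a ^ i \<le> n ^ i" using assms by (intro power_mono) auto
    also have "\<dots> \<le> n ^ (k - 1)" using assms \<open>i \<in> {..<k}\<close> by (intro power_increasing) auto
    finally have "real (k choose i) * c ^ (k - i) * a ^ i
      \<le> real (k choose i) * c ^ (k - i) * n ^ (k - 1)"
      using assms by (intro mult_left_mono) auto
    then show "real (k choose i) * a ^ i * c ^ (k - i)
      \<le> n ^ (k - 1) * (real (k choose i) * 1 ^ i * c ^ (k - i))"
      by (simp add: mult_ac)
  qed
  also have "\<dots> \<le> n ^ (k - 1) * (\<Sum>i\<le>k. real (k choose i) * 1 ^ i * c ^ (k - i))"
    unfolding sum_distrib_left[symmetric] using assms
    by (intro mult_left_mono sum_mono2) auto
  also have "\<dots> = (1 + c) ^ k * n ^ (k - 1)"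
    by (simp add: binomial_ring)
  finally show ?thesis by simp
qed

text \<open>Multiplied by \<open>fact k\<close>, the coefficient is a product of \<open>k\<close>
  factors, each at most \<open>r + k\<close>.\<close>

lemma multichoose_le_power: "real ((r + k - 1) choose k) \<le> real (r + k) ^ k / fact k"
proof -
  have "((r + k - 1) choose k) * fact k \<le> (r + k) ^ k"
    using binomial_fact_pow[of "r + k - 1" k] power_mono[of "r + k - 1" "r + k" k] by linarith
  then have "real (((r + k - 1) choose k) * fact k) \<le> real ((r + k) ^ k)"
    by (simp only: of_nat_le_iff)
  then show ?thesis by (simp add: pos_le_divide_eq)
qed

lemma divide_fact_le: "0 \<le> x \<Longrightarrow> x / fact k \<le> (x :: real)"
  using mult_left_mono[OF fact_ge_1[of k, where 'a = real], of x]
  by (simp add: pos_divide_le_eq)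

text \<open>Since \<open>\<gamma> \<le> 1\<close>, the error constant is free of
  \<open>\<gamma>\<close>. The integer exponent covers \<open>k = 0\<close>, where the error term is
  \<open>1 / n\<close>.\<close>

lemma multichoose_asymp:
  fixes \<gamma> :: real
  assumes "0 < \<gamma>" "\<gamma> \<le> 1" "n \<ge> 1" and r: "real r \<le> \<gamma> * real n"
  shows "real ((r + k - 1) choose k) \<le>
    \<gamma> ^ k / fact k * real n ^ k + (1 + real k) ^ k * real n powi (int k - 1)"
proof (cases "k = 0")
  case True
  then show ?thesis by (simp add: field_simps)
next
  case False
  have "real (r + k) ^ k \<le> (\<gamma> * real n + real k) ^ k"
    using r by (intro power_mono) auto
  also have "\<dots> \<le> (\<gamma> * real n) ^ k + (1 + real k) ^ k * real n ^ (k - 1)"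
    using assms False by (intro add_power_le) (auto simp: mult_left_le_one_le)
  finally have "real (r + k) ^ k / fact k \<le>
      ((\<gamma> * real n) ^ k + (1 + real k) ^ k * real n ^ (k - 1)) / fact k"
    by (intro divide_right_mono) auto
  also have "\<dots> \<le> (\<gamma> * real n) ^ k / fact k + (1 + real k) ^ k * real n ^ (k - 1)"
    unfolding add_divide_distrib by (intro add_left_mono divide_fact_le) simp
  also have "real n ^ (k - 1) = real n powi (int k - 1)"
    using False by (simp add: power_int_def nat_diff_distrib')
  finally show ?thesis
    using multichoose_le_power[of r k] by (simp add: power_mult_distrib)
qed

text \<open>For the lower-order terms, with \<open>k = t - j\<close> and \<open>d = t - s\<close>:
  \<open>n + k\<close> is at most \<open>(1 + k) * n\<close>, and \<open>k < d\<close> absorbs the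
  power.\<close>

lemma multichoose_le_powi:
  assumes "n \<ge> 1" "k < d"
  shows "real ((n + k - 1) choose k) \<le> (1 + real k) ^ k * real n powi (int d - 1)"
proof -
  have "real (n + k) ^ k \<le> ((1 + real k) * real n) ^ k"
    using assms by (intro power_mono) (auto simp: algebra_simps mult_le_cancel_left1)
  also have "\<dots> \<le> (1 + real k) ^ k * real n ^ (d - 1)"
    unfolding power_mult_distrib
    using assms by (intro mult_left_mono power_increasing) auto
  finally have "real (n + k) ^ k \<le> (1 + real k) ^ k * real n powi (int d - 1)"
    using assms by (simp add: power_int_def nat_diff_distrib')
  moreover have "real (n + k) ^ k / fact k \<le> real (n + k) ^ k"
    by (rule divide_fact_le) simp
  ultimately show ?thesis using multichoose_le_power[of n k] by linarith
qed

text \<open>\<open>K\<close> is chosen before \<open>\<gamma>\<close>, \<open>q\<close>,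
  \<open>n\<close> and \<open>C\<close>, so it depends only on \<open>s\<close>, \<open>t\<close>,
  \<open>m\<close>; the threshold for \<open>n\<close> is fixed before \<open>C\<close>.\<close>

theorem corollary1p4:
  fixes s t m :: nat
  assumes "1 \<le> s" and "s \<le> t" and "1 \<le> m"
  shows "\<exists>K::real. 0 \<le> K \<and>
    (\<forall>(\<gamma>::real) (q::nat). 0 < \<gamma> \<and> \<gamma> \<le> 1 \<and> 2 \<le> q \<longrightarrow>
      (\<forall>\<^sub>F n in sequentially. \<forall>C :: nat list set.
        reconstruction_code n q (m + 1) s C \<and>
        (\<forall>x\<in>C. real (num_runs x) \<le> \<gamma> * real n) \<longrightarrow>
        (\<exists>N::nat. reconstruction_code n q (N + 1) t C \<and>
          real N \<le> real m * \<gamma> ^ (t - s) / fact (t - s) * real n ^ (t - s)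
                    + K * real n powi (int t - int s - 1))))"
proof -
  define d where "d = t - s"
  \<comment> \<open>The first summand is \<open>m\<close> times the error constant of
    \<open>multichoose_asymp\<close>; the sum collects the short maximal words.\<close>
  define K where "K = real m * (1 + real d) ^ d +
    (\<Sum>j\<in>{s<..t}. real ((2 * j) choose j) * (1 + real (t - j)) ^ (t - j))"
  have d: "int t - int s - 1 = int d - 1" using assms by (simp add: d_def)
  have bound: "\<exists>N::nat. reconstruction_code n q (N + 1) t C \<and>
      real N \<le> real m * \<gamma> ^ d / fact d * real n ^ d + K * real n powi (int d - 1)"
    if \<gamma>: "0 < \<gamma>" "\<gamma> \<le> 1" and n: "n \<ge> max 1 t"
      and C: "reconstruction_code n q (m + 1) s C"
      and runs: "\<forall>x\<in>C. real (num_runs x) \<le> \<gamma> * real n"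
    for \<gamma> :: real and q n :: nat and C :: "nat list set"
  proof -
    define R where "R = real m * \<gamma> ^ d / fact d * real n ^ d + K * real n powi (int d - 1)"
    have "0 \<le> R" unfolding R_def K_def using \<gamma>
      by (intro add_nonneg_nonneg mult_nonneg_nonneg divide_nonneg_nonneg sum_nonneg) auto
    have le: "real (card (deletion_ball q t x \<inter> deletion_ball q t y)) \<le> R"
      if xy: "x \<in> C" "y \<in> C" "x \<noteq> y" for x y
    proof -
      have w: "x \<in> words q n" "y \<in> words q n"
        using C xy by (auto simp: reconstruction_code_def)
      then have ball: "deletion_ball q u x = deletions u x" "deletion_ball q u y = deletions u y"
        if "u \<le> n" for u
        using that by (simp_all add: deletion_ball_eq_deletions)
      have "card (deletion_ball q s x \<inter> deletion_ball q s y) < m + 1"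
        using C xy unfolding reconstruction_code_def by blast
      then have m: "card (deletions s x \<inter> deletions s y) \<le> m"
        using ball[of s] n assms by simp
      have "card (deletions t x \<inter> deletions t y) \<le>
        m * ((num_runs x + (t - s) - 1) choose (t - s)) +
        (\<Sum>j\<in>{s<..t}. ((2 * j) choose j) * ((n + (t - j) - 1) choose (t - j)))"
        using w assms m
        by (intro card_common_deletions_le length_remdups_adj_le_num_runs) (auto simp: words_def)
      then have "real (card (deletions t x \<inter> deletions t y)) \<le>
        real (m * ((num_runs x + (t - s) - 1) choose (t - s)) +
        (\<Sum>j\<in>{s<..t}. ((2 * j) choose j) * ((n + (t - j) - 1) choose (t - j))))"
        by (simp only: of_nat_le_iff)
      also have "\<dots> = real m * real ((num_runs x + d - 1) choose d) +
        (\<Sum>j\<in>{s<..t}. real ((2 * j) choose j) * real ((n + (t - j) - 1) choose (t - j)))"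
        by (simp add: d_def)
      also have "\<dots> \<le> real m *
          (\<gamma> ^ d / fact d * real n ^ d + (1 + real d) ^ d * real n powi (int d - 1)) +
        (\<Sum>j\<in>{s<..t}. real ((2 * j) choose j) *
          ((1 + real (t - j)) ^ (t - j) * real n powi (int d - 1)))"
        using \<gamma> n runs xy
        by (intro add_mono mult_left_mono sum_mono multichoose_asymp multichoose_le_powi)
          (auto simp: d_def)
      also have "\<dots> = R"
        by (simp add: R_def K_def algebra_simps sum_distrib_left sum_distrib_right)
      finally show ?thesis using ball[of t] n by simp
    qed
    \<comment> \<open>The witness \<open>N\<close> is the floor of \<open>R\<close>: an integer
      count at most \<open>R\<close> is at most its floor.\<close>
    have "card (deletion_ball q t x \<inter> deletion_ball q t y) < nat \<lfloor>R\<rfloor> + 1"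
      if "x \<in> C" "y \<in> C" "x \<noteq> y" for x y
      using le[OF that] by (simp add: less_Suc_eq_le le_nat_floor)
    moreover have "C \<subseteq> words q n" using C by (simp add: reconstruction_code_def)
    ultimately have "reconstruction_code n q (nat \<lfloor>R\<rfloor> + 1) t C"
      unfolding reconstruction_code_def by blast
    moreover have "real (nat \<lfloor>R\<rfloor>) \<le> R" using \<open>0 \<le> R\<close> by simp
    ultimately show ?thesis unfolding R_def by blast
  qed
  have "0 \<le> K" unfolding K_def by (intro add_nonneg_nonneg mult_nonneg_nonneg sum_nonneg) auto
  then show ?thesis
    unfolding d d_def[symmetric]
    by (intro exI[of _ K] conjI allI impI eventually_sequentiallyI[of "max 1 t"])
      (assumption, (rule bound; blast))
qed

end
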